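(* Let $Q$ be a connected finite acyclic quiver with vertices $1,\dots,n$ labelled as in the context, and let $X(Q)$ be its frieze variety. If $a_\ast\in X(Q)$ is a generic point, then $\mu_\ast(a_\ast)\in X(Q)$. Here "generic" means: for each irreducible component $X_i$ of $X(Q)$ there is a countable intersection $U_i$ of dense Zariski-open subsets of $X_i$ such that every $a_\ast$ in any of the sets $U_i$ has all coordinates nonzero and satisfies $\mu_\ast(a_\ast)\in X(Q)$.
   Context: $Q$ is a connected finite quiver without oriented cycles (multiple arrows allowed), with vertices labelled $1,\dots,n$ so that if there is an arrow $i\to j$ then $i>j$. Coxeter mutation: for $a_\ast=(a_1,\dots,a_n)\in(\mathbb{C}^\times)^n$ put $\mu_\ast(a_\ast)=(a_1',\dots,a_n')\in\mathbb{C}^n$, where recursively for $k=1,\dots,n$ $$a_k'=\frac{1+\prod_{j\to k}a_j\prod_{k\to j}a_j'}{a_k},$$ the products running over all arrows of $Q$ ending at $k$, respectively starting at $k$, counted with multiplicity. (This is the specialization at $x_i=a_i$ of the cluster obtained from the initial cluster $\mathbf{x}=(x_1,\dots,x_n)$ of the cluster algebra of $Q$ by the mutation sequence $\mu_n\circ\cdots\circ\mu_2\circ\mu_1$.) $\mu_\ast^t$ denotes the $t$-fold iterate. The frieze variety $X(Q)$ is the Zariski closure in $\mathbb{C}^n$ of the set $\{\mu_\ast^t(1,1,\dots,1):t\ge 0\}$ (all these points have positive rational coordinates, so they are defined). *)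

theory Defs
  imports "HOL-Analysis.Analysis" "Graph_Theory.Graph_Theory"
begin

section \<open>The Zariski topology on complex affine space\<close>

text \<open>A point of \<open>\<complex>\<^sup>n\<close> is a function on \<open>{1..n}\<close>, set to \<open>undefined\<close> elsewhere, so that
  equality of points is equality of the coordinates.\<close>

definition affine_space :: "nat \<Rightarrow> (nat \<Rightarrow> complex) set" where
  "affine_space n = {1..n} \<rightarrow>\<^sub>E UNIV"

text \<open>The polynomials in the coordinates \<open>x\<^sub>1, \<dots>, x\<^sub>n\<close>, regarded as functions. This loses nothing,
  because \<open>\<complex>\<close> is infinite.\<close>

inductive_set polynomial_functions :: "nat \<Rightarrow> ((nat \<Rightarrow> complex) \<Rightarrow> complex) set" for n :: nat where
  const: "(\<lambda>x. c) \<in> polynomial_functions n"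
| coord: "k \<in> {1..n} \<Longrightarrow> (\<lambda>x. x k) \<in> polynomial_functions n"
| add: "f \<in> polynomial_functions n \<Longrightarrow> g \<in> polynomial_functions n
    \<Longrightarrow> (\<lambda>x. f x + g x) \<in> polynomial_functions n"
| mult: "f \<in> polynomial_functions n \<Longrightarrow> g \<in> polynomial_functions n
    \<Longrightarrow> (\<lambda>x. f x * g x) \<in> polynomial_functions n"

definition zero_locus :: "nat \<Rightarrow> ((nat \<Rightarrow> complex) \<Rightarrow> complex) set \<Rightarrow> (nat \<Rightarrow> complex) set" where
  "zero_locus n F = {x \<in> affine_space n. \<forall>f\<in>F. f x = 0}"

definition zariski :: "nat \<Rightarrow> (nat \<Rightarrow> complex) topology" where
  "zariski n =
    topology (\<lambda>U. \<exists>F. F \<subseteq> polynomial_functions n \<and> U = affine_space n - zero_locus n F)"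

lemma istopology_zariski:
  "istopology (\<lambda>U. \<exists>F. F \<subseteq> polynomial_functions n \<and> U = affine_space n - zero_locus n F)"
proof -
  have int: "\<exists>H. H \<subseteq> polynomial_functions n \<and>
      (affine_space n - zero_locus n F) \<inter> (affine_space n - zero_locus n G)
        = affine_space n - zero_locus n H"
    if F: "F \<subseteq> polynomial_functions n" and G: "G \<subseteq> polynomial_functions n" for F G
  proof (intro exI conjI)
    let ?H = "(\<lambda>(f, g) x. f x * g x) ` (F \<times> G)"
    show "?H \<subseteq> polynomial_functions n"
      using F G by (auto intro: polynomial_functions.mult)
    show "(affine_space n - zero_locus n F) \<inter> (affine_space n - zero_locus n G)
        = affine_space n - zero_locus n ?H"
      by (fastforce simp: zero_locus_def)
  qed
  have un: "\<exists>H. H \<subseteq> polynomial_functions n \<and> \<Union>\<K> = affine_space n - zero_locus n H"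
    if K: "\<forall>K\<in>\<K>. \<exists>F. F \<subseteq> polynomial_functions n \<and> K = affine_space n - zero_locus n F"
    for \<K>
  proof -
    obtain F where F: "\<And>K. K \<in> \<K> \<Longrightarrow> F K \<subseteq> polynomial_functions n"
      "\<And>K. K \<in> \<K> \<Longrightarrow> K = affine_space n - zero_locus n (F K)"
      using K by metis
    have mem: "x \<in> K \<longleftrightarrow> x \<in> affine_space n \<and> (\<exists>f\<in>F K. f x \<noteq> 0)" if "K \<in> \<K>" for x K
      by (subst F(2)[OF that]) (auto simp: zero_locus_def)
    show ?thesis
    proof (intro exI conjI)
      show "(\<Union>K\<in>\<K>. F K) \<subseteq> polynomial_functions n"
        using F(1) by blast
      show "\<Union>\<K> = affine_space n - zero_locus n (\<Union>K\<in>\<K>. F K)"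
        by (auto simp: zero_locus_def mem)
    qed
  qed
  show ?thesis
    unfolding istopology_def using int un by blast
qed

lemma openin_zariski:
  "openin (zariski n) U \<longleftrightarrow>
    (\<exists>F. F \<subseteq> polynomial_functions n \<and> U = affine_space n - zero_locus n F)"
  by (simp add: zariski_def topology_inverse'[OF istopology_zariski])

lemma topspace_zariski: "topspace (zariski n) = affine_space n"
proof
  show "topspace (zariski n) \<subseteq> affine_space n"
    using openin_zariski openin_topspace by blast
  have "{\<lambda>x. 1} \<subseteq> polynomial_functions n"
    by (simp add: polynomial_functions.const)
  moreover have "affine_space n = affine_space n - zero_locus n {\<lambda>x. 1}"
    by (simp add: zero_locus_def)
  ultimately have "openin (zariski n) (affine_space n)"
    unfolding openin_zariski by blast
  then show "affine_space n \<subseteq> topspace (zariski n)"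
    by (rule openin_subset)
qed

lemma closedin_zariski:
  "closedin (zariski n) S \<longleftrightarrow> (\<exists>F. F \<subseteq> polynomial_functions n \<and> S = zero_locus n F)"
proof -
  have sub: "zero_locus n F \<subseteq> affine_space n" for F
    by (auto simp: zero_locus_def)
  show ?thesis
    unfolding closedin_def topspace_zariski openin_zariski
    using sub by (metis double_diff order_refl)
qed


section \<open>Irreducible components\<close>

definition irreducible_in :: "'a topology \<Rightarrow> 'a set \<Rightarrow> bool" where
  "irreducible_in X S \<longleftrightarrow> S \<subseteq> topspace X \<and> S \<noteq> {} \<and>
    (\<forall>A B. closedin X A \<and> closedin X B \<and> S \<subseteq> A \<union> B \<longrightarrow> S \<subseteq> A \<or> S \<subseteq> B)"

definition irreducible_component :: "'a topology \<Rightarrow> 'a set \<Rightarrow> 'a set \<Rightarrow> bool" where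
  "irreducible_component X V C \<longleftrightarrow> C \<subseteq> V \<and> irreducible_in X C \<and>
    (\<forall>D. D \<subseteq> V \<and> irreducible_in X D \<and> C \<subseteq> D \<longrightarrow> D = C)"

definition dense_open_in :: "'a topology \<Rightarrow> 'a set \<Rightarrow> bool" where
  "dense_open_in X U \<longleftrightarrow> openin X U \<and> X closure_of U = topspace X"


section \<open>Coxeter mutation and the frieze variety\<close>

text \<open>An arrow \<open>i \<rightarrow> j\<close> is an arc with tail \<open>i\<close> and head \<open>j\<close>; parallel arcs are allowed.
  Connectedness is that of the underlying undirected graph, and includes nonemptiness.
  Acyclicity already follows from \<open>labelling\<close>.\<close>

locale labelled_acyclic_quiver = fin_digraph Q
  for Q :: "(nat, 'e) pre_digraph" and n :: nat +
  assumes verts_eq: "verts Q = {1..n}"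
    and connected: "Digraph_Component.connected Q"
    and acyclic: "\<nexists>p. cycle p"
    and labelling: "e \<in> arcs Q \<Longrightarrow> tail Q e > head Q e"
begin

function mutated_coord :: "(nat \<Rightarrow> complex) \<Rightarrow> nat \<Rightarrow> complex" where
  "mutated_coord a k =
    (1 + (\<Prod>e\<in>{e \<in> arcs Q. head Q e = k}. a (tail Q e))
       * (\<Prod>e\<in>{e \<in> arcs Q. tail Q e = k}. mutated_coord a (head Q e))) / a k"
  by pat_completeness auto
termination
  by (relation "Wellfounded.measure snd") (auto dest: labelling)

declare mutated_coord.simps [simp del]

text \<open>Only meaningful when all coordinates of \<open>a\<close> are nonzero, as division by zero yields zero.\<close>

definition coxeter_mutation :: "(nat \<Rightarrow> complex) \<Rightarrow> nat \<Rightarrow> complex" where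
  "coxeter_mutation a = (\<lambda>k\<in>{1..n}. mutated_coord a k)"

definition frieze_point :: "nat \<Rightarrow> nat \<Rightarrow> complex" where
  "frieze_point t = (coxeter_mutation ^^ t) (\<lambda>k\<in>{1..n}. 1)"

definition frieze_variety :: "(nat \<Rightarrow> complex) set" where
  "frieze_variety = zariski n closure_of range frieze_point"

end

end

theory Submission
  imports Defs "HOL-Library.Function_Algebras"
begin

text \<open>
  Call \<open>X\<close> the frieze variety, \<open>S\<close> the orbit of \<open>(1,\<dots>,1)\<close>, and \<open>T\<close> the set of points with no
  vanishing coordinate. For every component \<open>C\<close> of \<open>X\<close> the single set \<open>C \<inter> T\<close> can serve as the
  set of generic points, for two reasons.

  First, mutation maps all of \<open>X \<inter> T\<close> into \<open>X\<close>. On \<open>T\<close> the coordinates of the mutated point are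
  Laurent polynomials in the coordinates of \<open>a\<close>, visibly so from the recursion, which divides by
  nothing but the \<open>a\<^sub>k\<close>. If the polynomial \<open>g\<close> vanishes on \<open>S\<close>, then multiplying its pullback under
  mutation by a power of \<open>x\<^sub>1 \<cdots> x\<^sub>n\<close> gives a polynomial which vanishes on \<open>S\<close> as well, as mutation
  maps \<open>S\<close> into itself. Hence it vanishes on \<open>X\<close>, and on \<open>T\<close> the power can be cancelled
  (\<open>coxeter_mutation_in_frieze_variety\<close>).

  Second, \<open>C \<inter> T\<close> is open in the irreducible set \<open>C\<close>, so it is dense as soon as it is nonempty.
  The points of \<open>S\<close> have positive coordinates, so \<open>S \<subseteq> T\<close>. Decompose \<open>X\<close> into finitely many
  irreducible closed sets and discard those that miss \<open>T\<close>; the rest still cover \<open>S\<close>, hence \<open>X\<close>, and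
  so \<open>C\<close> is one of them (\<open>irreducible_component_of_closure_meets_open\<close>). The finite decomposition
  exists because the Zariski topology is noetherian, which comes from Hilbert's basis theorem,
  proved below by comparing ideals of leading coefficients (\<open>noetherian_adjoin\<close>).
\<close>


section \<open>Hilbert's basis theorem for subrings of a commutative ring\<close>

text \<open>The rings are subsets of one ambient ring, so that the rings of polynomial functions in
  increasingly many coordinates are nested and no change of type is involved.\<close>

definition subring_of_type :: "'a::comm_ring_1 set \<Rightarrow> bool" where
  "subring_of_type R \<longleftrightarrow> - 1 \<in> R \<and> (\<forall>a\<in>R. \<forall>b\<in>R. a + b \<in> R \<and> a * b \<in> R)"

definition ideal_in :: "'a::comm_ring_1 set \<Rightarrow> 'a set \<Rightarrow> bool" where
  "ideal_in R I \<longleftrightarrow> I \<subseteq> R \<and> 0 \<in> I \<and> (\<forall>a\<in>I. \<forall>b\<in>I. a + b \<in> I) \<and> (\<forall>r\<in>R. \<forall>a\<in>I. r * a \<in> I)"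

definition noetherian_subring :: "'a::comm_ring_1 set \<Rightarrow> bool" where
  "noetherian_subring R \<longleftrightarrow>
    (\<forall>I :: nat \<Rightarrow> 'a set. (\<forall>j. ideal_in R (I j)) \<and> mono I \<longrightarrow> (\<exists>N. \<forall>j\<ge>N. I j = I N))"

primrec polys_below :: "'a::comm_ring_1 set \<Rightarrow> 'a \<Rightarrow> nat \<Rightarrow> 'a set" where
  "polys_below R x 0 = {0}"
| "polys_below R x (Suc d) = {r * x ^ d + q |r q. r \<in> R \<and> q \<in> polys_below R x d}"

definition adjoin :: "'a::comm_ring_1 set \<Rightarrow> 'a \<Rightarrow> 'a set" where
  "adjoin R x = (\<Union>d. polys_below R x d)"

text \<open>As \<open>x\<close> may be algebraic over \<open>R\<close>, an element can have several expressions as a polynomial in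
  \<open>x\<close>. Every coefficient of \<open>x ^ d\<close> that occurs in an expression of degree at most \<open>d\<close> of an
  element of \<open>I\<close> is admitted, zero included, so that these coefficients form an ideal of \<open>R\<close>.\<close>

definition leading_coeffs :: "'a::comm_ring_1 set \<Rightarrow> 'a \<Rightarrow> nat \<Rightarrow> 'a set \<Rightarrow> 'a set" where
  "leading_coeffs R x d I = {r \<in> R. \<exists>q\<in>polys_below R x d. r * x ^ d + q \<in> I}"

context
  fixes R :: "'a::comm_ring_1 set" and x :: 'a
  assumes R: "subring_of_type R"
begin

lemma subring_closed:
  shows "a \<in> R \<Longrightarrow> b \<in> R \<Longrightarrow> a + b \<in> R" "a \<in> R \<Longrightarrow> b \<in> R \<Longrightarrow> a * b \<in> R" "- 1 \<in> R"
  using R by (auto simp: subring_of_type_def)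

lemma subring_one: "1 \<in> R"
  using subring_closed(2)[OF subring_closed(3) subring_closed(3)] by simp

lemma subring_zero: "0 \<in> R"
  using subring_closed(1)[OF subring_one subring_closed(3)] by simp

lemma polys_below_zero: "0 \<in> polys_below R x d"
  by (induction d) (use subring_zero in force)+

lemma polys_below_add:
  "p \<in> polys_below R x d \<Longrightarrow> q \<in> polys_below R x d \<Longrightarrow> p + q \<in> polys_below R x d"
proof (induction d arbitrary: p q)
  case (Suc d)
  obtain r p' s q' where *: "p = r * x ^ d + p'" "q = s * x ^ d + q'" "r \<in> R" "s \<in> R"
    "p' \<in> polys_below R x d" "q' \<in> polys_below R x d"
    using Suc.prems by auto
  have "p + q = (r + s) * x ^ d + (p' + q')"
    by (simp add: * algebra_simps)
  moreover have "r + s \<in> R" "p' + q' \<in> polys_below R x d"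
    using Suc.IH * subring_closed(1) by auto
  ultimately show ?case
    by (subst polys_below.simps(2)) blast
qed auto

lemma polys_below_smult: "c \<in> R \<Longrightarrow> p \<in> polys_below R x d \<Longrightarrow> c * p \<in> polys_below R x d"
proof (induction d arbitrary: p)
  case (Suc d)
  obtain r p' where *: "p = r * x ^ d + p'" "r \<in> R" "p' \<in> polys_below R x d"
    using Suc.prems by auto
  have "c * p = (c * r) * x ^ d + c * p'"
    by (simp add: * algebra_simps)
  moreover have "c * r \<in> R" "c * p' \<in> polys_below R x d"
    using Suc * subring_closed(2) by auto
  ultimately show ?case
    by (subst polys_below.simps(2)) blast
qed auto

lemma polys_below_diff:
  "p \<in> polys_below R x d \<Longrightarrow> q \<in> polys_below R x d \<Longrightarrow> p - q \<in> polys_below R x d"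
  using polys_below_add[of p d "- 1 * q"] polys_below_smult[OF subring_closed(3), of q d] by simp

lemma polys_below_times_x: "p \<in> polys_below R x d \<Longrightarrow> x * p \<in> polys_below R x (Suc d)"
proof (induction d arbitrary: p)
  case 0
  then show ?case using polys_below_zero[of "Suc 0"] by simp
next
  case (Suc d)
  obtain r p' where *: "p = r * x ^ d + p'" "r \<in> R" "p' \<in> polys_below R x d"
    using Suc.prems by auto
  have "x * p = r * x ^ Suc d + x * p'"
    by (simp add: * algebra_simps)
  then show ?case
    using Suc.IH[OF *(3)] *(2) by (subst polys_below.simps(2)) blast
qed

lemma polys_below_mono: "d \<le> e \<Longrightarrow> polys_below R x d \<subseteq> polys_below R x e"
proof (induction rule: dec_induct)
  case (step e)
  have "polys_below R x e \<subseteq> polys_below R x (Suc e)"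
  proof
    fix q assume "q \<in> polys_below R x e"
    moreover have "q = 0 * x ^ e + q" by simp
    ultimately show "q \<in> polys_below R x (Suc e)"
      using subring_zero by (subst polys_below.simps(2)) blast
  qed
  then show ?case using step by blast
qed simp

lemma adjoin_base: "R \<subseteq> adjoin R x"
proof
  fix r assume "r \<in> R"
  then have "r \<in> polys_below R x (Suc 0)" by simp
  then show "r \<in> adjoin R x" unfolding adjoin_def by blast
qed

lemma adjoin_add: "p \<in> adjoin R x \<Longrightarrow> q \<in> adjoin R x \<Longrightarrow> p + q \<in> adjoin R x"
proof -
  assume "p \<in> adjoin R x" "q \<in> adjoin R x"
  then obtain d e where "p \<in> polys_below R x d" "q \<in> polys_below R x e"
    unfolding adjoin_def by blast
  then have "p \<in> polys_below R x (max d e)" "q \<in> polys_below R x (max d e)"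
    using polys_below_mono[of d "max d e"] polys_below_mono[of e "max d e"] by auto
  then show ?thesis
    using polys_below_add unfolding adjoin_def by blast
qed

lemma adjoin_smult: "c \<in> R \<Longrightarrow> p \<in> adjoin R x \<Longrightarrow> c * p \<in> adjoin R x"
  unfolding adjoin_def using polys_below_smult by blast

lemma adjoin_times_x: "p \<in> adjoin R x \<Longrightarrow> x * p \<in> adjoin R x"
  unfolding adjoin_def using polys_below_times_x by blast

lemma adjoin_gen: "x \<in> adjoin R x"
  using adjoin_times_x[of 1] adjoin_base subring_one by auto

lemma adjoin_mult: "p \<in> adjoin R x \<Longrightarrow> q \<in> adjoin R x \<Longrightarrow> p * q \<in> adjoin R x"
proof -
  assume q: "q \<in> adjoin R x"
  have power: "x ^ d * q \<in> adjoin R x" for d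
    by (induction d) (use q adjoin_times_x in \<open>auto simp: mult.assoc\<close>)
  have "p * q \<in> adjoin R x" if "p \<in> polys_below R x d" for p d
    using that
  proof (induction d arbitrary: p)
    case 0
    then show ?case using adjoin_base subring_zero by auto
  next
    case (Suc d)
    then obtain r p' where *: "p = r * x ^ d + p'" "r \<in> R" "p' \<in> polys_below R x d"
      by auto
    have "p * q = r * (x ^ d * q) + p' * q"
      by (simp add: * algebra_simps)
    then show ?case
      using adjoin_add adjoin_smult * power Suc.IH by auto
  qed
  then show "p \<in> adjoin R x \<Longrightarrow> ?thesis"
    unfolding adjoin_def by blast
qed

lemma ideal_in_leading_coeffs:
  assumes I: "ideal_in (adjoin R x) I"
  shows "ideal_in R (leading_coeffs R x d I)"
  unfolding ideal_in_def
proof (intro conjI ballI)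
  show "leading_coeffs R x d I \<subseteq> R"
    by (auto simp: leading_coeffs_def)
  show "0 \<in> leading_coeffs R x d I"
    using subring_zero polys_below_zero I
    by (auto simp: leading_coeffs_def ideal_in_def intro!: bexI[of _ 0])
next
  fix a b assume a: "a \<in> leading_coeffs R x d I" and b: "b \<in> leading_coeffs R x d I"
  then obtain p q where *: "p \<in> polys_below R x d" "a * x ^ d + p \<in> I"
    "q \<in> polys_below R x d" "b * x ^ d + q \<in> I" "a \<in> R" "b \<in> R"
    by (auto simp: leading_coeffs_def)
  have "(a + b) * x ^ d + (p + q) = (a * x ^ d + p) + (b * x ^ d + q)"
    by (simp add: algebra_simps)
  also have "\<dots> \<in> I"
    using I * by (auto simp: ideal_in_def)
  finally show "a + b \<in> leading_coeffs R x d I"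
    using polys_below_add * subring_closed by (auto simp: leading_coeffs_def)
next
  fix c a assume c: "c \<in> R" and "a \<in> leading_coeffs R x d I"
  then obtain p where *: "p \<in> polys_below R x d" "a * x ^ d + p \<in> I" "a \<in> R"
    by (auto simp: leading_coeffs_def)
  have "(c * a) * x ^ d + c * p = c * (a * x ^ d + p)"
    by (simp add: algebra_simps)
  also have "\<dots> \<in> I"
    using I * c adjoin_base unfolding ideal_in_def by blast
  finally show "c * a \<in> leading_coeffs R x d I"
    using polys_below_smult * c subring_closed by (auto simp: leading_coeffs_def)
qed

lemma leading_coeffs_mono_ideal: "I \<subseteq> J \<Longrightarrow> leading_coeffs R x d I \<subseteq> leading_coeffs R x d J"
  by (auto simp: leading_coeffs_def)

text \<open>Multiplication by \<open>x\<close> raises the degree and keeps the leading coefficient.\<close>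

lemma leading_coeffs_mono_degree:
  assumes I: "ideal_in (adjoin R x) I" and "d \<le> e"
  shows "leading_coeffs R x d I \<subseteq> leading_coeffs R x e I"
  using \<open>d \<le> e\<close>
proof (induction rule: dec_induct)
  case (step e)
  have "leading_coeffs R x e I \<subseteq> leading_coeffs R x (Suc e) I"
  proof
    fix r assume "r \<in> leading_coeffs R x e I"
    then obtain q where *: "r \<in> R" "q \<in> polys_below R x e" "r * x ^ e + q \<in> I"
      by (auto simp: leading_coeffs_def)
    have "r * x ^ Suc e + x * q = x * (r * x ^ e + q)"
      by (simp add: algebra_simps)
    also have "\<dots> \<in> I"
      using I * adjoin_gen by (auto simp: ideal_in_def)
    finally show "r \<in> leading_coeffs R x (Suc e) I"
      using * polys_below_times_x unfolding leading_coeffs_def by blast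
  qed
  then show ?case using step by blast
qed simp

text \<open>Nested ideals with the same leading coefficients in every degree coincide, since an element of
  the larger one can be reduced degree by degree by elements of the smaller one.\<close>

lemma ideal_subset_if_leading_coeffs:
  assumes I: "ideal_in (adjoin R x) I" and J: "ideal_in (adjoin R x) J" and "I \<subseteq> J"
    and lead: "\<And>d. leading_coeffs R x d J \<subseteq> leading_coeffs R x d I"
  shows "J \<subseteq> I"
proof -
  have "p \<in> I" if "p \<in> J" "p \<in> polys_below R x d" for p d
    using that
  proof (induction d arbitrary: p)
    case 0
    then show ?case using I by (simp add: ideal_in_def)
  next
    case (Suc d)
    then obtain r q where p: "p = r * x ^ d + q" "r \<in> R" "q \<in> polys_below R x d"
      by auto
    with Suc.prems have "r \<in> leading_coeffs R x d J"
      by (auto simp: leading_coeffs_def)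
    with lead obtain q' where q': "q' \<in> polys_below R x d" "r * x ^ d + q' \<in> I"
      by (fastforce simp: leading_coeffs_def)
    have "- 1 * (r * x ^ d + q') \<in> J"
      using J q' \<open>I \<subseteq> J\<close> adjoin_base subring_closed(3) unfolding ideal_in_def by blast
    then have "p + - 1 * (r * x ^ d + q') \<in> J"
      using J Suc.prems unfolding ideal_in_def by blast
    then have "q - q' \<in> J"
      by (simp add: p)
    then have "q - q' \<in> I"
      using Suc.IH polys_below_diff p q' by blast
    then have "(r * x ^ d + q') + (q - q') \<in> I"
      using I q' unfolding ideal_in_def by blast
    then show ?case by (simp add: p)
  qed
  then show ?thesis
    using J unfolding ideal_in_def adjoin_def by blast
qed

text \<open>The ideals \<open>leading_coeffs R x d (I j)\<close> increase in both indices. The diagonal \<open>d = j\<close>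
  stabilises at some \<open>N\<close>, which settles all degrees \<open>d \<ge> N\<close> simultaneously; the finitely many lower
  degrees are treated one by one.\<close>

theorem noetherian_adjoin:
  assumes noeth: "noetherian_subring R"
  shows "noetherian_subring (adjoin R x)"
  unfolding noetherian_subring_def
proof (intro allI impI)
  fix I :: "nat \<Rightarrow> 'a set"
  assume "(\<forall>j. ideal_in (adjoin R x) (I j)) \<and> mono I"
  then have I: "\<And>j. ideal_in (adjoin R x) (I j)" and mono: "mono I"
    by auto
  let ?L = "\<lambda>d j. leading_coeffs R x d (I j)"
  have L_mono: "?L d i \<subseteq> ?L e j" if "d \<le> e" "i \<le> j" for d e i j
    using leading_coeffs_mono_degree[OF I that(1)] leading_coeffs_mono_ideal
      monoD[OF mono that(2)] by blast
  have stable: "\<exists>N. \<forall>j\<ge>N. J j = J N" if "\<And>j. ideal_in R (J j)" "mono J"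
    for J :: "nat \<Rightarrow> 'a set"
    using noeth[unfolded noetherian_subring_def, THEN spec, of J] that by simp
  have "mono (\<lambda>j. ?L j j)"
    by (intro monoI L_mono)
  from stable[OF ideal_in_leading_coeffs[OF I] this] have "\<exists>N. \<forall>j\<ge>N. ?L j j = ?L N N" .
  then obtain N where N: "\<And>j. j \<ge> N \<Longrightarrow> ?L j j = ?L N N" by blast
  have "\<exists>M. \<forall>j\<ge>M. ?L d j = ?L d M" for d
  proof -
    have "mono (?L d)"
      by (intro monoI L_mono order_refl)
    from stable[OF ideal_in_leading_coeffs[OF I] this] show ?thesis .
  qed
  then obtain M where M: "\<And>d j. j \<ge> M d \<Longrightarrow> ?L d j = ?L d (M d)" by metis
  \<comment> \<open>From \<open>K\<close> on, the diagonal and every degree below \<open>N\<close> are stable.\<close>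
  define K where "K = Max (insert N (M ` {..<N}))"
  have KN: "N \<le> K" and KM: "\<And>d. d < N \<Longrightarrow> M d \<le> K"
    by (auto simp: K_def)
  have "I j = I K" if "K \<le> j" for j
  proof
    show "I K \<subseteq> I j" using monoD[OF mono that] .
    show "I j \<subseteq> I K"
    proof (rule ideal_subset_if_leading_coeffs[OF I I])
      show "I K \<subseteq> I j" using monoD[OF mono that] .
      show "?L d j \<subseteq> ?L d K" for d
      \<comment> \<open>For \<open>d \<ge> N\<close> the ideal is squeezed between two values on the stable part of the diagonal.\<close>
      proof (cases "d < N")
        case True
        then show ?thesis using M[of d j] M[of d K] KM[of d] that by auto
      next
        case False
        have "?L d j \<subseteq> ?L (max d j) (max d j)" by (rule L_mono) auto
        also have "\<dots> = ?L N N" using False by (intro N) auto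
        also have "\<dots> \<subseteq> ?L d K" using False KN by (intro L_mono) auto
        finally show ?thesis .
      qed
    qed
  qed
  then show "\<exists>N. \<forall>j\<ge>N. I j = I N" by blast
qed

end


section \<open>The Zariski topology is noetherian\<close>

lemma subring_polynomial_functions: "subring_of_type (polynomial_functions n)"
  using polynomial_functions.const[of "- 1" n] polynomial_functions.add[of _ n]
    polynomial_functions.mult[of _ n]
  by (auto simp: subring_of_type_def plus_fun_def times_fun_def fun_Compl_def one_fun_def)

lemma polynomial_functions_mono:
  assumes "f \<in> polynomial_functions n" "n \<le> m"
  shows "f \<in> polynomial_functions m"
  using assms by induction (auto intro: polynomial_functions.intros)

lemma polynomial_functions_Suc:
  "polynomial_functions (Suc n) = adjoin (polynomial_functions n) (\<lambda>x. x (Suc n))"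
    (is "?P = adjoin ?R ?x")
proof
  note R = subring_polynomial_functions[of n]
  show "?P \<subseteq> adjoin ?R ?x"
  proof
    fix f assume "f \<in> ?P"
    then show "f \<in> adjoin ?R ?x"
    proof induction
      case (const c)
      then show ?case using adjoin_base[OF R] polynomial_functions.const by blast
    next
      case (coord k)
      show ?case
      proof (cases "k = Suc n")
        case True
        then show ?thesis using adjoin_gen[OF R] by simp
      next
        case False
        then have "(\<lambda>x. x k) \<in> ?R" using coord by (intro polynomial_functions.coord) auto
        then show ?thesis using adjoin_base[OF R] by blast
      qed
    next
      case (add f g)
      then show ?case using adjoin_add[OF R, of f ?x g] by (simp add: plus_fun_def)
    next
      case (mult f g)
      then show ?case using adjoin_mult[OF R, of f ?x g] by (simp add: times_fun_def)
    qed
  qed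
  note P = subring_polynomial_functions[of "Suc n"]
  have x: "?x \<in> ?P" by (intro polynomial_functions.coord) auto
  have x_power: "?x ^ d \<in> ?P" for d
    by (induction d)
      (simp_all only: power_0 power_Suc x subring_one[OF P] subring_closed(2)[OF P])
  have "f \<in> ?P" if "f \<in> polys_below ?R ?x d" for f d
    using that
  proof (induction d arbitrary: f)
    case 0
    then have "f = 0" by simp
    then show ?case using subring_zero[OF P] by (simp only:)
  next
    case (Suc d)
    then obtain r q where *: "f = r * ?x ^ d + q" "r \<in> ?R" "q \<in> polys_below ?R ?x d"
      unfolding polys_below.simps by blast
    have "r \<in> ?P" using polynomial_functions_mono[OF *(2)] by simp
    then show ?case
      unfolding *(1) by (intro subring_closed[OF P] x_power Suc.IH[OF *(3)])
  qed
  then show "adjoin ?R ?x \<subseteq> ?P"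
    unfolding adjoin_def by blast
qed

text \<open>An ideal of the field of constants is determined by whether it contains a nonzero element.\<close>

lemma noetherian_constants: "noetherian_subring (polynomial_functions 0)"
  unfolding noetherian_subring_def
proof (intro allI impI)
  fix I :: "nat \<Rightarrow> ((nat \<Rightarrow> complex) \<Rightarrow> complex) set"
  assume asm: "(\<forall>j. ideal_in (polynomial_functions 0) (I j)) \<and> mono I"
  have const: "\<exists>c. f = (\<lambda>x. c)" if "f \<in> polynomial_functions 0" for f
    using that by induction auto
  have all: "I j = polynomial_functions 0" if f: "f \<in> I j" "f \<noteq> 0" for f j
  proof -
    have id: "ideal_in (polynomial_functions 0) (I j)" using asm by blast
    obtain c where c: "f = (\<lambda>x. c)" using const f id unfolding ideal_in_def by blast
    have "c \<noteq> 0" using f c by (auto simp: zero_fun_def)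
    have "g \<in> I j" if g: "g \<in> polynomial_functions 0" for g
    proof -
      obtain b where b: "g = (\<lambda>x. b)" using const g by blast
      have "(\<lambda>x. b / c) * f \<in> I j"
        using id f polynomial_functions.const unfolding ideal_in_def by blast
      then show ?thesis using \<open>c \<noteq> 0\<close> by (simp add: b c times_fun_def)
    qed
    then show ?thesis using id unfolding ideal_in_def by blast
  qed
  show "\<exists>N. \<forall>j\<ge>N. I j = I N"
  proof (cases "\<exists>N. \<exists>f\<in>I N. f \<noteq> 0")
    case True
    then obtain N f where "f \<in> I N" "f \<noteq> 0" by blast
    then show ?thesis
      using all monoD[OF conjunct2[OF asm], of N] by blast
  next
    case False
    then have "I j = {0}" for j using asm unfolding ideal_in_def by blast
    then show ?thesis by simp
  qed
qed

lemma noetherian_polynomial_functions: "noetherian_subring (polynomial_functions n)"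
  by (induction n) (use noetherian_constants noetherian_adjoin subring_polynomial_functions
      in \<open>auto simp: polynomial_functions_Suc\<close>)

text \<open>A closed set is recovered from its ideal, so a strictly descending chain of closed sets would
  give a strictly ascending chain of ideals.\<close>

lemma wf_closedin_zariski:
  "wf {(A, B). closedin (zariski n) A \<and> closedin (zariski n) B \<and> A \<subset> B}"
  unfolding wf_iff_no_infinite_down_chain
proof
  assume "\<exists>A. \<forall>i. (A (Suc i), A i) \<in>
    {(A, B). closedin (zariski n) A \<and> closedin (zariski n) B \<and> A \<subset> B}"
  then obtain A where A: "\<forall>i. (A (Suc i), A i) \<in>
    {(A, B). closedin (zariski n) A \<and> closedin (zariski n) B \<and> A \<subset> B}" ..
  have closed: "closedin (zariski n) (A i)" and less: "A (Suc i) \<subset> A i" for i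
    using A[THEN spec, of i] by simp_all
  define I where "I i = {f \<in> polynomial_functions n. \<forall>x\<in>A i. f x = 0}" for i
  have "ideal_in (polynomial_functions n) (I i)" for i
    using subring_zero[OF subring_polynomial_functions[of n]]
      subring_closed[OF subring_polynomial_functions[of n]]
    by (auto simp: ideal_in_def I_def zero_fun_def plus_fun_def times_fun_def)
  moreover have "A j \<subseteq> A i" if "i \<le> j" for i j
    using lift_Suc_antimono_le[of A i j] less that by blast
  then have "mono I"
    by (auto simp: mono_def I_def)
  ultimately obtain N where N: "\<And>j. j \<ge> N \<Longrightarrow> I j = I N"
    using noetherian_polynomial_functions[of n] unfolding noetherian_subring_def by meson
  have recover: "A i = zero_locus n (I i)" for i
  proof -
    obtain F where F: "F \<subseteq> polynomial_functions n" "A i = zero_locus n F"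
      using closed closedin_zariski by blast
    then have "F \<subseteq> I i" by (auto simp: I_def zero_locus_def)
    then show ?thesis using F(2) by (auto simp: zero_locus_def I_def)
  qed
  have "A (Suc N) = A N"
    using recover[of N] recover[of "Suc N"] N[of "Suc N"] by simp
  then show False using less by blast
qed

text \<open>Noetherian induction: a nonempty reducible closed set is the union of two proper closed
  subsets.\<close>

lemma finite_irreducible_decomposition:
  assumes "closedin (zariski n) A"
  shows "\<exists>\<F>. finite \<F> \<and> (\<forall>B\<in>\<F>. closedin (zariski n) B \<and> irreducible_in (zariski n) B) \<and> A = \<Union>\<F>"
  using wf_closedin_zariski[of n] assms
proof (induction A rule: wf_induct_rule)
  case (less A)
  have sub: "A \<subseteq> topspace (zariski n)" using less.prems closedin_subset by blast
  consider "A = {}" | "irreducible_in (zariski n) A"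
    | B B' where "closedin (zariski n) B" "closedin (zariski n) B'" "A \<subseteq> B \<union> B'"
      "\<not> A \<subseteq> B" "\<not> A \<subseteq> B'"
    using sub unfolding irreducible_in_def by blast
  then show ?case
  proof cases
    case 1
    then show ?thesis by (intro exI[of _ "{}"]) auto
  next
    case 2
    then show ?thesis using less.prems by (intro exI[of _ "{A}"]) auto
  next
    case (3 B B')
    have "closedin (zariski n) (A \<inter> B)" "closedin (zariski n) (A \<inter> B')"
      using 3 less.prems by auto
    moreover have "A \<inter> B \<subset> A" "A \<inter> B' \<subset> A" using 3 by auto
    ultimately obtain \<F> \<F>' where
      F: "finite \<F>" "\<forall>B\<in>\<F>. closedin (zariski n) B \<and> irreducible_in (zariski n) B" "A \<inter> B = \<Union>\<F>"
      and F': "finite \<F>'" "\<forall>B\<in>\<F>'. closedin (zariski n) B \<and> irreducible_in (zariski n) B"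
        "A \<inter> B' = \<Union>\<F>'"
      using less.IH[of "A \<inter> B"] less.IH[of "A \<inter> B'"] less.prems by auto
    have "A = (A \<inter> B) \<union> (A \<inter> B')" using 3(3) by blast
    then have "A = \<Union>(\<F> \<union> \<F>')" by (simp only: F(3) F'(3) Union_Un_distrib)
    then show ?thesis using F F' by (intro exI[of _ "\<F> \<union> \<F>'"]) auto
  qed
qed


section \<open>Irreducible components and open sets\<close>

lemma irreducible_in_finite_Union:
  assumes "finite \<F>" "irreducible_in X S" "\<And>B. B \<in> \<F> \<Longrightarrow> closedin X B" "S \<subseteq> \<Union>\<F>"
  shows "\<exists>B\<in>\<F>. S \<subseteq> B"
  using assms(1,3,4)
proof (induction \<F>)
  case empty
  then show ?case using assms(2) by (auto simp: irreducible_in_def)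
next
  case (insert B \<F>)
  have "closedin X (\<Union>\<F>)" using insert by (intro closedin_Union) auto
  then have "S \<subseteq> B \<or> S \<subseteq> \<Union>\<F>"
    using assms(2) insert.prems unfolding irreducible_in_def by (metis Union_insert insertI1)
  then show ?case using insert by auto
qed

text \<open>In a finite decomposition of the closure of \<open>S\<close>, the pieces that miss an open set containing
  \<open>S\<close> are redundant.\<close>

lemma irreducible_component_of_closure_meets_open:
  assumes C: "irreducible_component (zariski n) (zariski n closure_of S) C"
    and U: "openin (zariski n) U" and "S \<subseteq> U"
  shows "C \<inter> U \<noteq> {}"
proof -
  obtain \<F> where F: "finite \<F>"
    "\<And>B. B \<in> \<F> \<Longrightarrow> closedin (zariski n) B" "\<And>B. B \<in> \<F> \<Longrightarrow> irreducible_in (zariski n) B"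
    "zariski n closure_of S = \<Union>\<F>"
    using finite_irreducible_decomposition[OF closedin_closure_of, of n S] by metis
  define \<G> where "\<G> = {B \<in> \<F>. B \<inter> U \<noteq> {}}"
  have "S \<subseteq> zariski n closure_of S"
    using openin_subset[OF U] \<open>S \<subseteq> U\<close> by (intro closure_of_subset) (rule order_trans)
  then have "S \<subseteq> \<Union>\<F>"
    by (simp only: F(4))
  then have "S \<subseteq> \<Union>\<G>"
    using \<open>S \<subseteq> U\<close> unfolding \<G>_def by blast
  moreover have "closedin (zariski n) (\<Union>\<G>)"
    using F by (intro closedin_Union) (auto simp: \<G>_def)
  ultimately have "zariski n closure_of S \<subseteq> \<Union>\<G>"
    by (rule closure_of_minimal)
  with C have "C \<subseteq> \<Union>\<G>" "irreducible_in (zariski n) C"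
    by (auto simp: irreducible_component_def)
  then obtain B where B: "B \<in> \<G>" "C \<subseteq> B"
    using irreducible_in_finite_Union[of \<G> "zariski n" C] F by (auto simp: \<G>_def)
  then have "B \<subseteq> zariski n closure_of S" "irreducible_in (zariski n) B"
    using F by (auto simp: \<G>_def)
  with C B have "B = C"
    by (auto simp: irreducible_component_def)
  then show ?thesis using B by (auto simp: \<G>_def)
qed

lemma irreducible_in_dense_open:
  assumes C: "irreducible_in X C" and U: "openin X U" and "C \<inter> U \<noteq> {}"
  shows "dense_open_in (subtopology X C) (C \<inter> U)"
  unfolding dense_open_in_def
proof
  show "openin (subtopology X C) (C \<inter> U)"
    using U by (rule openin_subtopology_Int2)
  have sub: "C \<subseteq> topspace X" using C by (simp add: irreducible_in_def)
  have "C \<inter> U \<subseteq> X closure_of (C \<inter> U)"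
    using sub by (intro closure_of_subset) auto
  then have "C \<subseteq> X closure_of (C \<inter> U) \<union> (topspace X - U)"
    using sub by blast
  moreover have "\<not> C \<subseteq> topspace X - U" using \<open>C \<inter> U \<noteq> {}\<close> by blast
  moreover have "closedin X (topspace X - U)" using U by blast
  ultimately have "C \<subseteq> X closure_of (C \<inter> U)"
    using C closedin_closure_of unfolding irreducible_in_def by blast
  then show "subtopology X C closure_of (C \<inter> U) = topspace (subtopology X C)"
    using sub by (simp add: closure_of_subtopology inf.absorb1 inf.absorb2)
qed


section \<open>Laurent polynomials on the torus\<close>

definition torus :: "nat \<Rightarrow> (nat \<Rightarrow> complex) set" where
  "torus n = {a \<in> affine_space n. \<forall>k\<in>{1..n}. a k \<noteq> 0}"

definition laurent_on_torus :: "nat \<Rightarrow> ((nat \<Rightarrow> complex) \<Rightarrow> complex) \<Rightarrow> bool" where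
  "laurent_on_torus n g \<longleftrightarrow>
    (\<exists>m. \<exists>p\<in>polynomial_functions n. \<forall>a\<in>torus n. (\<Prod>k\<in>{1..n}. a k) ^ m * g a = p a)"

lemma polynomial_functions_prod:
  assumes "finite K" "\<And>k. k \<in> K \<Longrightarrow> f k \<in> polynomial_functions n"
  shows "(\<lambda>a. \<Prod>k\<in>K. f k a) \<in> polynomial_functions n"
  using assms by (induction K) (auto intro: polynomial_functions.intros)

lemma polynomial_functions_power:
  "f \<in> polynomial_functions n \<Longrightarrow> (\<lambda>a. f a ^ m) \<in> polynomial_functions n"
  by (induction m) (auto intro: polynomial_functions.intros)

lemma polynomial_functions_prod_coords: "(\<lambda>a. \<Prod>k\<in>{1..n}. a k) \<in> polynomial_functions n"
  by (intro polynomial_functions_prod polynomial_functions.coord) auto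

lemma openin_torus: "openin (zariski n) (torus n)"
proof -
  have "torus n = affine_space n - zero_locus n {\<lambda>a. \<Prod>k\<in>{1..n}. a k}"
    by (auto simp: torus_def zero_locus_def)
  then show ?thesis
    unfolding openin_zariski using polynomial_functions_prod_coords by blast
qed

lemma laurent_on_torus_polynomial:
  "f \<in> polynomial_functions n \<Longrightarrow> laurent_on_torus n f"
  unfolding laurent_on_torus_def by (intro exI[of _ 0] bexI[of _ f]) auto

lemma laurent_on_torus_add:
  assumes "laurent_on_torus n f" "laurent_on_torus n g"
  shows "laurent_on_torus n (\<lambda>a. f a + g a)"
proof -
  let ?x = "\<lambda>a. \<Prod>k\<in>{1..n}. a k :: complex"
  obtain m p m' p' where *: "p \<in> polynomial_functions n" "p' \<in> polynomial_functions n"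
    "\<And>a. a \<in> torus n \<Longrightarrow> ?x a ^ m * f a = p a" "\<And>a. a \<in> torus n \<Longrightarrow> ?x a ^ m' * g a = p' a"
    using assms unfolding laurent_on_torus_def by blast
  show ?thesis
    unfolding laurent_on_torus_def
  proof (intro exI[of _ "m + m'"] bexI ballI)
    show "?x a ^ (m + m') * (f a + g a) = ?x a ^ m' * p a + ?x a ^ m * p' a"
      if "a \<in> torus n" for a
      by (simp add: *(3,4)[OF that, symmetric] power_add algebra_simps)
    show "(\<lambda>a. ?x a ^ m' * p a + ?x a ^ m * p' a) \<in> polynomial_functions n"
      by (intro polynomial_functions.add polynomial_functions.mult polynomial_functions_power
          polynomial_functions_prod_coords *)
  qed
qed

lemma laurent_on_torus_mult:
  assumes "laurent_on_torus n f" "laurent_on_torus n g"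
  shows "laurent_on_torus n (\<lambda>a. f a * g a)"
proof -
  let ?x = "\<lambda>a. \<Prod>k\<in>{1..n}. a k :: complex"
  obtain m p m' p' where *: "p \<in> polynomial_functions n" "p' \<in> polynomial_functions n"
    "\<And>a. a \<in> torus n \<Longrightarrow> ?x a ^ m * f a = p a" "\<And>a. a \<in> torus n \<Longrightarrow> ?x a ^ m' * g a = p' a"
    using assms unfolding laurent_on_torus_def by blast
  show ?thesis
    unfolding laurent_on_torus_def
  proof (intro exI[of _ "m + m'"] bexI ballI)
    show "?x a ^ (m + m') * (f a * g a) = p a * p' a" if "a \<in> torus n" for a
      by (simp add: *(3,4)[OF that, symmetric] power_add algebra_simps)
    show "(\<lambda>a. p a * p' a) \<in> polynomial_functions n"
      by (intro polynomial_functions.mult *)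
  qed
qed

lemma laurent_on_torus_prod:
  assumes "finite K" "\<And>k. k \<in> K \<Longrightarrow> laurent_on_torus n (f k)"
  shows "laurent_on_torus n (\<lambda>a. \<Prod>k\<in>K. f k a)"
  using assms
  by (induction K)
    (auto intro: laurent_on_torus_mult laurent_on_torus_polynomial polynomial_functions.const)

lemma laurent_on_torus_divide_coord:
  assumes "laurent_on_torus n f" "k \<in> {1..n}"
  shows "laurent_on_torus n (\<lambda>a. f a / a k)"
proof -
  have "laurent_on_torus n (\<lambda>a. 1 / a k)"
    unfolding laurent_on_torus_def
  proof (intro exI[of _ 1] bexI ballI)
    show "(\<Prod>i\<in>{1..n}. a i) ^ 1 * (1 / a k) = (\<Prod>i\<in>{1..n} - {k}. a i)" if "a \<in> torus n" for a
    proof -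
      have "a k \<noteq> 0" using that assms(2) by (simp add: torus_def)
      then show ?thesis
        using prod.remove[OF finite_atLeastAtMost assms(2), of a] by simp
    qed
    show "(\<lambda>a. \<Prod>i\<in>{1..n} - {k}. a i) \<in> polynomial_functions n"
      by (intro polynomial_functions_prod polynomial_functions.coord) auto
  qed
  from laurent_on_torus_mult[OF assms(1) this] show ?thesis by simp
qed


section \<open>Mutation on the frieze variety\<close>

context labelled_acyclic_quiver
begin

lemma tail_in_range: "e \<in> arcs Q \<Longrightarrow> tail Q e \<in> {1..n}"
  and head_in_range: "e \<in> arcs Q \<Longrightarrow> head Q e \<in> {1..n}"
  using tail_in_verts head_in_verts verts_eq by blast+

text \<open>The recursive calls are at heads of arrows starting at \<open>k\<close>, which have smaller labels.\<close>

lemma laurent_mutated_coord: "k \<in> {1..n} \<Longrightarrow> laurent_on_torus n (\<lambda>a. mutated_coord a k)"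
proof (induction k rule: less_induct)
  case (less k)
  show ?case
  proof (subst mutated_coord.simps, intro laurent_on_torus_divide_coord laurent_on_torus_add
      laurent_on_torus_mult laurent_on_torus_prod laurent_on_torus_polynomial[of "\<lambda>a. 1"]
      polynomial_functions.const)
    show "laurent_on_torus n (\<lambda>a. a (tail Q e))" if "e \<in> {e \<in> arcs Q. head Q e = k}" for e
      using that tail_in_range by (intro laurent_on_torus_polynomial polynomial_functions.coord) auto
    show "laurent_on_torus n (\<lambda>a. mutated_coord a (head Q e))"
      if "e \<in> {e \<in> arcs Q. tail Q e = k}" for e
      using that less.IH[of "head Q e"] labelling[of e] head_in_range[of e] by auto
  qed (use less.prems in auto)
qed

lemma laurent_pullback:
  assumes "g \<in> polynomial_functions n"
  shows "laurent_on_torus n (\<lambda>a. g (coxeter_mutation a))"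
  using assms
proof induction
  case (const c)
  then show ?case by (intro laurent_on_torus_polynomial polynomial_functions.const)
next
  case (coord k)
  then show ?case using laurent_mutated_coord by (simp add: coxeter_mutation_def)
qed (auto intro: laurent_on_torus_add laurent_on_torus_mult)

text \<open>The recursion involves no subtraction, so positive coordinates stay positive. This keeps the
  orbit of \<open>(1,\<dots>,1)\<close> inside the torus.\<close>

lemma mutated_coord_pos:
  assumes "\<And>i. i \<in> {1..n} \<Longrightarrow> \<exists>r>0. a i = complex_of_real r"
  shows "k \<in> {1..n} \<Longrightarrow> \<exists>r>0. mutated_coord a k = complex_of_real r"
proof (induction k rule: less_induct)
  case (less k)
  have prod_pos: "\<exists>r>0. prod f K = complex_of_real r"
    if "\<And>e. e \<in> K \<Longrightarrow> \<exists>r>0. f e = complex_of_real r" for f and K :: "'e set"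
  proof -
    obtain r where "\<And>e. e \<in> K \<Longrightarrow> r e > 0 \<and> f e = complex_of_real (r e)"
      using \<open>\<And>e. e \<in> K \<Longrightarrow> \<exists>r>0. f e = complex_of_real r\<close> by metis
    then show ?thesis
      by (intro exI[of _ "prod r K"]) (auto intro: prod_pos)
  qed
  obtain r where r: "r > 0"
    "(\<Prod>e\<in>{e \<in> arcs Q. head Q e = k}. a (tail Q e)) = complex_of_real r"
    using prod_pos[of "{e \<in> arcs Q. head Q e = k}" "\<lambda>e. a (tail Q e)"] assms tail_in_range
    by blast
  have "\<exists>s>0. mutated_coord a (head Q e) = complex_of_real s"
    if "e \<in> {e \<in> arcs Q. tail Q e = k}" for e
    using that less.IH[of "head Q e"] labelling[of e] head_in_range[of e] by auto
  then obtain s where s: "s > 0"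
    "(\<Prod>e\<in>{e \<in> arcs Q. tail Q e = k}. mutated_coord a (head Q e)) = complex_of_real s"
    using prod_pos[of "{e \<in> arcs Q. tail Q e = k}" "\<lambda>e. mutated_coord a (head Q e)"] by blast
  obtain t where t: "t > 0" "a k = complex_of_real t"
    using assms less.prems by blast
  have "mutated_coord a k = complex_of_real ((1 + r * s) / t)"
    by (subst mutated_coord.simps) (simp add: r s t)
  moreover have "(1 + r * s) / t > 0"
    using r s t by (simp add: add_pos_pos)
  ultimately show ?case by blast
qed

lemma frieze_point_pos: "k \<in> {1..n} \<Longrightarrow> \<exists>r>0. frieze_point t k = complex_of_real r"
proof (induction t arbitrary: k)
  case 0
  then show ?case by (auto simp: frieze_point_def intro!: exI[of _ 1])
next
  case (Suc t)
  have "frieze_point (Suc t) k = mutated_coord (frieze_point t) k"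
    using Suc.prems by (simp add: frieze_point_def coxeter_mutation_def)
  then show ?case
    using mutated_coord_pos[of "frieze_point t"] Suc by auto
qed

lemma coxeter_mutation_in_affine_space: "coxeter_mutation a \<in> affine_space n"
  by (simp add: affine_space_def coxeter_mutation_def)

lemma frieze_point_in_torus: "frieze_point t \<in> torus n"
proof -
  have "frieze_point t \<in> affine_space n"
    by (cases t) (use coxeter_mutation_in_affine_space in
        \<open>auto simp: frieze_point_def affine_space_def\<close>)
  moreover have "frieze_point t k \<noteq> 0" if "k \<in> {1..n}" for k
    using frieze_point_pos[OF that, of t] by auto
  ultimately show ?thesis by (simp add: torus_def)
qed

text \<open>The pullback of an equation of the frieze variety, once its denominator is cleared, vanishes on
  the orbit because mutation shifts the orbit; so it is again an equation of the variety.\<close>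

theorem coxeter_mutation_in_frieze_variety:
  assumes a: "a \<in> frieze_variety" "a \<in> torus n"
  shows "coxeter_mutation a \<in> frieze_variety"
proof -
  have orbit: "range frieze_point \<subseteq> affine_space n"
    using frieze_point_in_torus by (auto simp: torus_def)
  obtain F where F: "F \<subseteq> polynomial_functions n" "frieze_variety = zero_locus n F"
    using closedin_zariski closedin_closure_of unfolding frieze_variety_def by blast
  have vanish: "g (frieze_point t) = 0" if "g \<in> F" for g t
  proof -
    have "range frieze_point \<subseteq> frieze_variety"
      unfolding frieze_variety_def using orbit
      by (intro closure_of_subset) (simp add: topspace_zariski)
    then have "frieze_point t \<in> zero_locus n F" using F(2) by blast
    then show ?thesis using that by (simp add: zero_locus_def)
  qed
  have "g (coxeter_mutation a) = 0" if g: "g \<in> F" for g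
  proof -
    obtain m p where p: "p \<in> polynomial_functions n"
      "\<And>b. b \<in> torus n \<Longrightarrow> (\<Prod>k\<in>{1..n}. b k) ^ m * g (coxeter_mutation b) = p b"
      using laurent_pullback g F(1) unfolding laurent_on_torus_def by blast
    have "p (frieze_point t) = 0" for t
    proof -
      have "g (coxeter_mutation (frieze_point t)) = 0"
        using vanish[OF g, of "Suc t"] by (simp add: frieze_point_def)
      then show ?thesis using p(2)[OF frieze_point_in_torus, of t] by simp
    qed
    then have "range frieze_point \<subseteq> zero_locus n {p}"
      using orbit by (auto simp: zero_locus_def)
    moreover have "closedin (zariski n) (zero_locus n {p})"
      using p(1) closedin_zariski by blast
    ultimately have "frieze_variety \<subseteq> zero_locus n {p}"
      unfolding frieze_variety_def by (rule closure_of_minimal)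
    then have "p a = 0" using a by (auto simp: zero_locus_def)
    moreover have "(\<Prod>k\<in>{1..n}. a k) ^ m \<noteq> 0" using a by (auto simp: torus_def)
    ultimately show ?thesis using p(2)[OF a(2)] by (metis mult_eq_0_iff)
  qed
  then show ?thesis
    using F(2) coxeter_mutation_in_affine_space by (simp add: zero_locus_def)
qed

end


section \<open>Generic points of the frieze variety\<close>

theorem corollary2p4:
  fixes Q :: "(nat, 'e) pre_digraph" and n :: nat
  assumes "labelled_acyclic_quiver Q n"
  shows "\<forall>C. irreducible_component (zariski n) (labelled_acyclic_quiver.frieze_variety Q n) C \<longrightarrow>
    (\<exists>\<U>. countable \<U> \<and> \<U> \<noteq> {} \<and>
      (\<forall>U\<in>\<U>. dense_open_in (subtopology (zariski n) C) U) \<and>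
      (\<forall>a\<in>\<Inter>\<U>. (\<forall>k\<in>{1..n}. a k \<noteq> 0) \<and>
        labelled_acyclic_quiver.coxeter_mutation Q n a
          \<in> labelled_acyclic_quiver.frieze_variety Q n))"
proof (intro allI impI)
  interpret labelled_acyclic_quiver Q n by fact
  fix C assume C: "irreducible_component (zariski n) frieze_variety C"
  have "C \<inter> torus n \<noteq> {}"
    using irreducible_component_of_closure_meets_open[OF C[unfolded frieze_variety_def] openin_torus]
      frieze_point_in_torus by blast
  then have "dense_open_in (subtopology (zariski n) C) (C \<inter> torus n)"
    using C openin_torus by (auto simp: irreducible_component_def intro: irreducible_in_dense_open)
  moreover have "\<forall>a\<in>C \<inter> torus n. (\<forall>k\<in>{1..n}. a k \<noteq> 0) \<and> coxeter_mutation a \<in> frieze_variety"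
    using C coxeter_mutation_in_frieze_variety
    by (auto simp: irreducible_component_def torus_def)
  ultimately show "\<exists>\<U>. countable \<U> \<and> \<U> \<noteq> {} \<and>
      (\<forall>U\<in>\<U>. dense_open_in (subtopology (zariski n) C) U) \<and>
      (\<forall>a\<in>\<Inter>\<U>. (\<forall>k\<in>{1..n}. a k \<noteq> 0) \<and> coxeter_mutation a \<in> frieze_variety)"
    by (intro exI[of _ "{C \<inter> torus n}"]) auto
qed

end
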